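(* Let $BD_{J_A}$ be a basis-dependent discord measure on states of $\mathcal H_A\otimes\mathcal H_B$ (with respect to the fixed basis $J_A$ of $\mathcal H_A$). Then $$D(\rho_{AB})=\min_{U_A}BD_{J_A}\big((U_A\otimes I)\,\rho_{AB}\,(U_A^\dagger\otimes I)\big),$$ where the minimum is over all unitaries $U_A$ on $\mathcal H_A$, is a discord measure.
   Context: $\mathcal H_A,\mathcal H_B$ are finite-dimensional complex Hilbert spaces; states are density operators; $J_A=\{|j_A\rangle\}_{j_A=1}^{d_A}$ is a fixed orthonormal basis of $\mathcal H_A$. The minimum is understood as an infimum if it is not attained. Incoherent states of $A$ are the states diagonal in $J_A$. An operator $K$ on $\mathcal H_A$ is an incoherent Kraus operator if $K\sigma K^\dagger$ is diagonal in $J_A$ for every incoherent $\sigma$; an incoherent unitary is a unitary that is an incoherent Kraus operator. Incoherent-quantum (IQ) states: $\sum_{j_A}p_{j_A}|j_A\rangle\langle j_A|\otimes\rho_B^{j_A}$ with $p$ a probability distribution and $\rho_B^{j_A}$ states of $B$. Separable-quantum-incoherent (SQI) operations: $\Lambda_{SQI}(\rho_{AB})=\sum_n(A_n\otimes B_n)\rho_{AB}(A_n\otimes B_n)^\dagger$ with $\sum_nA_n^\dagger A_n\otimes B_n^\dagger B_n=I$, each $A_n$ an incoherent Kraus operator on $A$ and each $B_n$ an operator on $B$. A basis-dependent discord measure is a function $BD_{J_A}$ from states of $\mathcal H_A\otimes\mathcal H_B$ to $[0,\infty)$ such that: (BD1) it vanishes on IQ states; (BD2) $BD_{J_A}(\Lambda_{SQI}(\rho_{AB}))\le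 BD_{J_A}(\rho_{AB})$ for all SQI operations; (BD3) it is invariant under conjugation by $U_A\otimes U_B$ with $U_A$ an incoherent unitary on $A$ and $U_B$ any unitary on $B$. A discord measure is a function $D$ from states of $\mathcal H_A\otimes\mathcal H_B$ to $[0,\infty)$ such that: (D1) $D(\sigma_{AB})=0$ for every classical-quantum state $\sigma_{AB}=\sum_np_n|n\rangle\langle n|\otimes\rho_B^n$, where $\{|n\rangle\}$ is any orthonormal family in $\mathcal H_A$, $p$ is a probability distribution and $\rho_B^n$ are states of $B$; (D2) $D((I_A\otimes\Phi_B)(\rho_{AB}))\le D(\rho_{AB})$ for every completely positive trace-preserving map $\Phi_B$ on $B$ (here $I_A$ is the identity channel); (D3) $D((U_A\otimes U_B)\rho_{AB}(U_A\otimes U_B)^\dagger)=D(\rho_{AB})$ for all unitaries $U_A,U_B$. *)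

theory Defs
  imports "HOL-Analysis.Analysis"
begin

text \<open>
  A Hilbert space of dimension \<open>CARD('a)\<close> is rendered as \<open>complex ^ 'a\<close>, its operators as
  \<open>complex ^ 'a ^ 'a\<close>, and \<open>H\<^sub>A \<otimes> H\<^sub>B\<close> as \<open>complex ^ ('a \<times> 'b)\<close>.
  The distinguished basis of \<open>H\<^sub>A\<close> is not assumed to be the coordinate basis.
\<close>

definition cinner :: "complex ^ 'n \<Rightarrow> complex ^ 'n \<Rightarrow> complex" where
  "cinner v w = (\<Sum>i\<in>UNIV. cnj (v $ i) * w $ i)"

definition ketbra :: "complex ^ 'n \<Rightarrow> complex ^ 'n \<Rightarrow> complex ^ 'n ^ 'n" where
  "ketbra v w = (\<chi> i j. v $ i * cnj (w $ j))"

definition dagger :: "complex ^ 'n ^ 'm \<Rightarrow> complex ^ 'm ^ 'n" where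
  "dagger M = (\<chi> i j. cnj (M $ j $ i))"

definition cscale :: "complex \<Rightarrow> complex ^ 'n ^ 'm \<Rightarrow> complex ^ 'n ^ 'm" where
  "cscale c M = (\<chi> i j. c * M $ i $ j)"

definition kron ::
    "complex ^ 'a ^ 'a \<Rightarrow> complex ^ 'b ^ 'b \<Rightarrow> complex ^ ('a::finite \<times> 'b::finite) ^ ('a \<times> 'b)" where
  "kron M N = (\<chi> x y. M $ fst x $ fst y * N $ snd x $ snd y)"

definition unitary :: "complex ^ 'n ^ 'n \<Rightarrow> bool" where
  "unitary U \<longleftrightarrow> dagger U ** U = mat 1 \<and> U ** dagger U = mat 1"

text \<open>Over the complex numbers, a nonnegative real quadratic form already forces hermiticity.\<close>

definition psd :: "complex ^ 'n ^ 'n \<Rightarrow> bool" where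
  "psd M \<longleftrightarrow> (\<forall>v. cinner v (M *v v) \<in> \<real>\<^sub>\<ge>\<^sub>0)"

definition state :: "complex ^ 'n ^ 'n \<Rightarrow> bool" where
  "state \<rho> \<longleftrightarrow> psd \<rho> \<and> trace \<rho> = 1"

definition orthonormal_on :: "'i set \<Rightarrow> ('i \<Rightarrow> complex ^ 'n) \<Rightarrow> bool" where
  "orthonormal_on I v \<longleftrightarrow> (\<forall>i\<in>I. \<forall>j\<in>I. cinner (v i) (v j) = (if i = j then 1 else 0))"

text \<open>Indexing the family by the coordinate type gives it \<open>CARD('a)\<close> members, so it spans.\<close>

definition orthonormal_basis :: "('a \<Rightarrow> complex ^ 'a) \<Rightarrow> bool" where
  "orthonormal_basis J \<longleftrightarrow> orthonormal_on UNIV J"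

definition diagonal_in :: "('a \<Rightarrow> complex ^ 'a) \<Rightarrow> complex ^ 'a ^ 'a \<Rightarrow> bool" where
  "diagonal_in J M \<longleftrightarrow> (\<forall>j k. j \<noteq> k \<longrightarrow> cinner (J j) (M *v J k) = 0)"

definition incoherent_state :: "('a \<Rightarrow> complex ^ 'a) \<Rightarrow> complex ^ 'a ^ 'a \<Rightarrow> bool" where
  "incoherent_state J \<sigma> \<longleftrightarrow> state \<sigma> \<and> diagonal_in J \<sigma>"

definition incoherent_kraus :: "('a \<Rightarrow> complex ^ 'a) \<Rightarrow> complex ^ 'a ^ 'a \<Rightarrow> bool" where
  "incoherent_kraus J K \<longleftrightarrow>
     (\<forall>\<sigma>. incoherent_state J \<sigma> \<longrightarrow> diagonal_in J (K ** \<sigma> ** dagger K))"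

definition incoherent_unitary :: "('a \<Rightarrow> complex ^ 'a) \<Rightarrow> complex ^ 'a ^ 'a \<Rightarrow> bool" where
  "incoherent_unitary J U \<longleftrightarrow> unitary U \<and> incoherent_kraus J U"

definition IQ_state ::
    "('a \<Rightarrow> complex ^ 'a) \<Rightarrow> complex ^ ('a::finite \<times> 'b::finite) ^ ('a \<times> 'b) \<Rightarrow> bool" where
  "IQ_state J \<sigma> \<longleftrightarrow>
     (\<exists>(p :: 'a \<Rightarrow> real) (\<rho> :: 'a \<Rightarrow> complex ^ 'b ^ 'b).
        (\<forall>j. 0 \<le> p j) \<and> (\<Sum>j\<in>UNIV. p j) = 1 \<and> (\<forall>j. state (\<rho> j)) \<and>
        \<sigma> = (\<Sum>j\<in>UNIV. p j *\<^sub>R kron (ketbra (J j) (J j)) (\<rho> j)))"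

definition SQI_operation ::
    "('a \<Rightarrow> complex ^ 'a) \<Rightarrow>
     (complex ^ ('a::finite \<times> 'b::finite) ^ ('a \<times> 'b) \<Rightarrow> complex ^ ('a \<times> 'b) ^ ('a \<times> 'b)) \<Rightarrow> bool" where
  "SQI_operation J \<Lambda> \<longleftrightarrow>
     (\<exists>(N :: nat) (A :: nat \<Rightarrow> complex ^ 'a ^ 'a) (B :: nat \<Rightarrow> complex ^ 'b ^ 'b).
        (\<forall>n<N. incoherent_kraus J (A n)) \<and>
        (\<Sum>n<N. kron (dagger (A n) ** A n) (dagger (B n) ** B n)) = mat 1 \<and>
        \<Lambda> = (\<lambda>\<rho>. \<Sum>n<N. kron (A n) (B n) ** \<rho> ** dagger (kron (A n) (B n))))"

text \<open>
  Measures are total functions on operators of which only the values on states matter.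
\<close>

definition basis_dependent_discord ::
    "('a \<Rightarrow> complex ^ 'a) \<Rightarrow> (complex ^ ('a::finite \<times> 'b::finite) ^ ('a \<times> 'b) \<Rightarrow> real) \<Rightarrow> bool" where
  "basis_dependent_discord J BD \<longleftrightarrow>
     (\<forall>\<rho>. state \<rho> \<longrightarrow> 0 \<le> BD \<rho>) \<and>
     (\<forall>\<sigma>. IQ_state J \<sigma> \<longrightarrow> BD \<sigma> = 0) \<and>
     (\<forall>\<Lambda> \<rho>. SQI_operation J \<Lambda> \<longrightarrow> state \<rho> \<longrightarrow> BD (\<Lambda> \<rho>) \<le> BD \<rho>) \<and>
     (\<forall>U V \<rho>. incoherent_unitary J U \<longrightarrow> unitary V \<longrightarrow> state \<rho> \<longrightarrow>
        BD (kron U V ** \<rho> ** dagger (kron U V)) = BD \<rho>)"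

definition CQ_state :: "complex ^ ('a::finite \<times> 'b::finite) ^ ('a \<times> 'b) \<Rightarrow> bool" where
  "CQ_state \<sigma> \<longleftrightarrow>
     (\<exists>(N :: nat) (v :: nat \<Rightarrow> complex ^ 'a) (p :: nat \<Rightarrow> real) (\<rho> :: nat \<Rightarrow> complex ^ 'b ^ 'b).
        orthonormal_on {..<N} v \<and>
        (\<forall>n<N. 0 \<le> p n) \<and> (\<Sum>n<N. p n) = 1 \<and> (\<forall>n<N. state (\<rho> n)) \<and>
        \<sigma> = (\<Sum>n<N. p n *\<^sub>R kron (ketbra (v n) (v n)) (\<rho> n)))"

definition clinear_map :: "(complex ^ 'n ^ 'n \<Rightarrow> complex ^ 'n ^ 'n) \<Rightarrow> bool" where
  "clinear_map \<Phi> \<longleftrightarrow>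
     (\<forall>X Y. \<Phi> (X + Y) = \<Phi> X + \<Phi> Y) \<and> (\<forall>c X. \<Phi> (cscale c X) = cscale c (\<Phi> X))"

text \<open>
  An operator on \<open>\<complex>\<^sup>n \<otimes> H\<close> is an \<open>n \<times> n\<close> array of operators \<open>X i j\<close> on \<open>H\<close>, and a vector
  an \<open>n\<close>-tuple of vectors in \<open>H\<close>; the map \<open>id \<otimes> \<Phi>\<close> then acts entrywise on the array. This
  lets the ancilla dimension \<open>n\<close> be quantified inside the definition of complete positivity.
\<close>

definition block_psd :: "nat \<Rightarrow> (nat \<Rightarrow> nat \<Rightarrow> complex ^ 'n ^ 'n) \<Rightarrow> bool" where
  "block_psd n X \<longleftrightarrow>
     (\<forall>v :: nat \<Rightarrow> complex ^ 'n. (\<Sum>i<n. \<Sum>j<n. cinner (v i) (X i j *v v j)) \<in> \<real>\<^sub>\<ge>\<^sub>0)"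

definition completely_positive :: "(complex ^ 'n ^ 'n \<Rightarrow> complex ^ 'n ^ 'n) \<Rightarrow> bool" where
  "completely_positive \<Phi> \<longleftrightarrow> (\<forall>n X. block_psd n X \<longrightarrow> block_psd n (\<lambda>i j. \<Phi> (X i j)))"

definition cptp :: "(complex ^ 'n ^ 'n \<Rightarrow> complex ^ 'n ^ 'n) \<Rightarrow> bool" where
  "cptp \<Phi> \<longleftrightarrow> clinear_map \<Phi> \<and> completely_positive \<Phi> \<and> (\<forall>X. trace (\<Phi> X) = trace X)"

text \<open>
  \<open>id \<otimes> \<Phi>\<close> applies \<open>\<Phi>\<close> to each of the blocks \<open>\<langle>i|X|j\<rangle>\<close>, which are operators on \<open>H\<^sub>B\<close>.
\<close>

definition id_tensor ::
    "(complex ^ 'b ^ 'b \<Rightarrow> complex ^ 'b ^ 'b) \<Rightarrow>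
     complex ^ ('a::finite \<times> 'b::finite) ^ ('a \<times> 'b) \<Rightarrow> complex ^ ('a \<times> 'b) ^ ('a \<times> 'b)" where
  "id_tensor \<Phi> X = (\<chi> x y. \<Phi> (\<chi> k l. X $ (fst x, k) $ (fst y, l)) $ snd x $ snd y)"

lemma id_tensor_kron:
  assumes "clinear_map \<Phi>"
  shows "id_tensor \<Phi> (kron M N) = kron M (\<Phi> N)"
proof -
  have "\<Phi> (\<chi> k l. M $ i $ j * N $ k $ l) = cscale (M $ i $ j) (\<Phi> N)" for i j
    using assms by (simp add: clinear_map_def flip: cscale_def)
  then show ?thesis
    by (simp add: id_tensor_def kron_def vec_eq_iff) (simp add: cscale_def)
qed

definition discord_measure :: "(complex ^ ('a::finite \<times> 'b::finite) ^ ('a \<times> 'b) \<Rightarrow> real) \<Rightarrow> bool" where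
  "discord_measure D \<longleftrightarrow>
     (\<forall>\<rho>. state \<rho> \<longrightarrow> 0 \<le> D \<rho>) \<and>
     (\<forall>\<sigma>. CQ_state \<sigma> \<longrightarrow> D \<sigma> = 0) \<and>
     (\<forall>\<Phi> \<rho>. cptp \<Phi> \<longrightarrow> state \<rho> \<longrightarrow> D (id_tensor \<Phi> \<rho>) \<le> D \<rho>) \<and>
     (\<forall>U V \<rho>. unitary U \<longrightarrow> unitary V \<longrightarrow> state \<rho> \<longrightarrow>
        D (kron U V ** \<rho> ** dagger (kron U V)) = D \<rho>)"

end

theory Submission
  imports Defs
begin

text \<open>
  A local channel on \<open>B\<close> has a Kraus form \<open>\<Sum>\<^sub>n B\<^sub>n X B\<^sub>n\<^sup>\<dagger>\<close> (from a decomposition of its Choi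
  matrix into rank-one terms), hence is an SQI operation with every \<open>A\<^sub>n\<close> the identity, and it commutes
  with rotations of \<open>A\<close>; so (D2) follows from (BD2) unitary by unitary. For (D1), the family
  \<open>|n\<rangle>\<close> extends to an orthonormal basis, and the unitary taking this basis to \<open>J\<close> turns the
  classical-quantum state into an IQ state. For (D3), \<open>U\<^sub>A\<close> is absorbed into the minimisation and
  \<open>U\<^sub>B\<close> is removed by (BD3).
\<close>

section \<open>Matrix algebra\<close>

lemma sum_UNIV_prod: "(\<Sum>x\<in>UNIV. f x) = (\<Sum>i\<in>UNIV. \<Sum>k\<in>UNIV. f (i, k))"
  by (simp add: sum.cartesian_product flip: UNIV_Times_UNIV)

lemma matrix_mult_nth: "(A ** B) $ i $ j = (\<Sum>k\<in>UNIV. A $ i $ k * B $ k $ j)"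
  by (simp add: matrix_matrix_mult_def)

lemma dagger_nth [simp]: "dagger M $ i $ j = cnj (M $ j $ i)"
  by (simp add: dagger_def)

lemma kron_nth [simp]: "kron M N $ x $ y = M $ fst x $ fst y * N $ snd x $ snd y"
  by (simp add: kron_def)

lemma ketbra_nth [simp]: "ketbra v w $ i $ j = v $ i * cnj (w $ j)"
  by (simp add: ketbra_def)

lemma dagger_dagger [simp]: "dagger (dagger M) = M"
  by (simp add: vec_eq_iff)

lemma dagger_mat_1 [simp]: "dagger (mat 1) = mat 1"
  by (auto simp: vec_eq_iff mat_def)

lemma dagger_mult: "dagger (A ** B) = dagger B ** dagger A"
  by (simp add: vec_eq_iff matrix_mult_nth mult.commute)

lemma dagger_kron: "dagger (kron A B) = kron (dagger A) (dagger B)"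
  by (simp add: vec_eq_iff)

lemma kron_mult: "kron A B ** kron C D = kron (A ** C) (B ** D)"
  by (simp add: vec_eq_iff matrix_mult_nth sum_product sum.cartesian_product
      flip: UNIV_Times_UNIV)
    (simp add: split_def mult_ac)

lemma kron_mat_1 [simp]: "kron (mat 1) (mat 1) = mat 1"
  by (auto simp: vec_eq_iff mat_def prod_eq_iff)

lemma kron_sum_right: "kron A (\<Sum>n\<in>S. B n) = (\<Sum>n\<in>S. kron A (B n))"
  by (simp add: vec_eq_iff sum_distrib_left)

text \<open>The two-sided product is real-linear in its middle factor. Taking
  \<open>K = mat 1\<close> also covers right multiplication alone.\<close>

lemma conj_sum_scaleR:
  fixes K :: "complex ^ 'n ^ 'm" and L :: "complex ^ 'p ^ 'q"
  shows "K ** (\<Sum>n\<in>S. c n *\<^sub>R X n) ** L = (\<Sum>n\<in>S. c n *\<^sub>R (K ** X n ** L))"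
proof -
  have "K ** (X + Y) ** L = K ** X ** L + K ** Y ** L" for X Y
    by (simp add: vec_eq_iff matrix_mult_nth algebra_simps sum.distrib)
  moreover have "K ** (r *\<^sub>R X) ** L = r *\<^sub>R (K ** X ** L)" for r X
    by (simp add: vec_eq_iff matrix_mult_nth scaleR_sum_right sum_distrib_right)
  ultimately have "linear (\<lambda>X. K ** X ** L)"
    by (intro linearI) auto
  from linear_sum[OF this, of "\<lambda>n. c n *\<^sub>R X n" S] show ?thesis
    by (simp add: \<open>\<And>r X. K ** (r *\<^sub>R X) ** L = r *\<^sub>R (K ** X ** L)\<close>)
qed

lemma conj_sum:
  fixes K :: "complex ^ 'n ^ 'm" and L :: "complex ^ 'p ^ 'q"
  shows "K ** (\<Sum>n\<in>S. X n) ** L = (\<Sum>n\<in>S. K ** X n ** L)"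
  using conj_sum_scaleR[of K "\<lambda>_. 1" X S L] by simp

lemma ketbra_conj: "U ** ketbra v w ** dagger U = ketbra (U *v v) (U *v w)"
  by (simp add: vec_eq_iff matrix_mult_nth matrix_vector_mult_def sum_distrib_left sum_distrib_right mult_ac)

lemma trace_mult_commute: "trace (A ** B) = trace (B ** (A :: complex ^ 'n ^ 'm))"
  unfolding trace_def matrix_mult_nth by (subst sum.swap) (simp add: mult.commute)

lemma trace_sum: "trace (\<Sum>n\<in>S. X n) = (\<Sum>n\<in>S. trace (X n :: complex ^ 'n ^ 'n))"
  unfolding trace_def by (simp, subst sum.swap, simp)

lemma unitary_mult: "unitary U \<Longrightarrow> unitary V \<Longrightarrow> unitary (U ** V)"
  unfolding unitary_def dagger_mult
  by (metis matrix_mul_assoc matrix_mul_lid)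

lemma unitary_dagger: "unitary U \<Longrightarrow> unitary (dagger U)"
  by (simp add: unitary_def)

lemma unitary_mat_1 [simp]: "unitary (mat 1)"
  by (simp add: unitary_def)

lemma unitary_kron: "unitary U \<Longrightarrow> unitary V \<Longrightarrow> unitary (kron U V)"
  by (simp add: unitary_def dagger_kron kron_mult)

section \<open>Positive semidefinite matrices\<close>

lemma cinner_add_left: "cinner (u + v) w = cinner u w + cinner v w"
  and cinner_add_right: "cinner w (u + v) = cinner w u + cinner w v"
  and cinner_diff_left: "cinner (u - v) w = cinner u w - cinner v w"
  and cinner_diff_right: "cinner w (u - v) = cinner w u - cinner w v"
  by (simp_all add: cinner_def algebra_simps sum.distrib sum_subtractf)

lemma cnj_cinner: "cnj (cinner v w) = cinner w v"
  by (simp add: cinner_def mult.commute)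

lemma cinner_axis_left: "cinner (axis i a) w = cnj a * w $ i"
proof -
  have "cinner (axis i a) w = (\<Sum>k\<in>UNIV. if k = i then cnj a * w $ k else 0)"
    unfolding cinner_def axis_def by (rule sum.cong) auto
  then show ?thesis by simp
qed

lemma cinner_self: "cinner v v = of_real (\<Sum>i\<in>UNIV. (cmod (v $ i))\<^sup>2)"
  unfolding cinner_def of_real_sum
  by (rule sum.cong) (simp_all add: complex_norm_square mult.commute del: of_real_power)

lemma cinner_self_eq_0_iff: "cinner v v = 0 \<longleftrightarrow> v = 0"
  unfolding cinner_self of_real_eq_0_iff by (simp add: sum_nonneg_eq_0_iff vec_eq_iff)

lemma cinner_scale: "cinner (c *s v) (d *s w) = cnj c * d * cinner v w"
  by (simp add: cinner_def sum_distrib_left mult_ac)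

lemma cinner_adjoint: "cinner v (A *v w) = cinner (dagger A *v v) w"
  unfolding cinner_def matrix_vector_mult_def
  by (simp add: sum_distrib_left sum_distrib_right, subst sum.swap, simp add: mult_ac)

lemma matrix_vector_mult_axis: "M *v axis j b = (\<chi> i. M $ i $ j * (b::complex))"
proof -
  have "(\<Sum>k\<in>UNIV. M $ i $ k * axis j b $ k) = (\<Sum>k\<in>UNIV. if k = j then M $ i $ k * b else 0)" for i
    unfolding axis_def by (rule sum.cong) auto
  then show ?thesis by (simp add: matrix_vector_mult_def vec_eq_iff)
qed

lemma cinner_ketbra: "cinner u (ketbra v w *v x) = cinner u v * cinner w x"
  unfolding cinner_def sum_product matrix_vector_mult_def by (simp add: sum_distrib_left mult_ac)

lemma cinner_scaleR_mult: "cinner u ((r *\<^sub>R M) *v x) = r *\<^sub>R cinner u (M *v x)"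
  by (simp add: cinner_def matrix_vector_mult_def flip: scaleR_sum_right)

lemma cnj_mult_self_nonneg: "cnj z * z \<in> \<real>\<^sub>\<ge>\<^sub>0"
  by (simp add: complex_nonneg_Reals_iff)

lemma psd_ketbra: "psd (ketbra v v)"
  unfolding psd_def
proof
  fix u
  show "cinner u (ketbra v v *v u) \<in> \<real>\<^sub>\<ge>\<^sub>0"
    using cnj_mult_self_nonneg by (simp add: cinner_ketbra flip: cnj_cinner[of v u])
qed

lemma psd_conj: "psd M \<Longrightarrow> psd (K ** M ** dagger K)"
  unfolding psd_def
  by (metis cinner_adjoint matrix_vector_mul_assoc)

lemma psd_sum: "finite S \<Longrightarrow> (\<And>n. n \<in> S \<Longrightarrow> psd (M n)) \<Longrightarrow> psd (\<Sum>n\<in>S. M n)"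
proof (induction S rule: finite_induct)
  case empty
  then show ?case by (simp add: psd_def cinner_def)
next
  case (insert x S)
  then show ?case
    by (simp add: psd_def cinner_add_right matrix_vector_mult_add_rdistrib nonneg_Reals_add_I)
qed

lemma state_conj_unitary:
  assumes "state \<rho>" "unitary U"
  shows "state (U ** \<rho> ** dagger U)"
proof -
  have "trace (U ** \<rho> ** dagger U) = trace (dagger U ** U ** \<rho>)"
    by (metis trace_mult_commute matrix_mul_assoc)
  then show ?thesis
    using assms by (simp add: state_def psd_conj unitary_def)
qed

text \<open>This is the form evaluated at \<open>axis i a + axis j b\<close>, valid also for
  \<open>i = j\<close>. The facts below on diagonal entries, hermiticity and zero rows come from
  special choices of \<open>a\<close> and \<open>b\<close>.\<close>

lemma psd_quadratic:
  assumes "psd M"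
  shows "cnj a * M $ i $ i * a + cnj a * M $ i $ j * b + cnj b * M $ j $ i * a + cnj b * M $ j $ j * b
    \<in> \<real>\<^sub>\<ge>\<^sub>0"
proof -
  have "cinner (axis i a + axis j b) (M *v (axis i a + axis j b)) \<in> \<real>\<^sub>\<ge>\<^sub>0"
    using assms by (simp add: psd_def)
  then show ?thesis
    by (simp add: matrix_vector_right_distrib cinner_add_left cinner_add_right cinner_axis_left
        matrix_vector_mult_axis algebra_simps)
qed

lemma psd_diag: "psd M \<Longrightarrow> M $ i $ i \<in> \<real>\<^sub>\<ge>\<^sub>0"
  using psd_quadratic[of M 1 i i 0] by simp

text \<open>Polarisation: since the diagonal is real, \<open>b = 1\<close> makes the imaginary parts
  of the two off-diagonal entries cancel, and \<open>b = \<i>\<close> makes their real parts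
  agree.\<close>

lemma psd_hermitian:
  assumes "psd M"
  shows "M $ j $ i = cnj (M $ i $ j)"
proof -
  have "Im (M $ i $ i) = 0" "Im (M $ j $ j) = 0"
    using psd_diag[OF assms] by (simp_all add: complex_nonneg_Reals_iff)
  with psd_quadratic[OF assms, of 1 i j 1] psd_quadratic[OF assms, of 1 i j \<i>]
  show ?thesis by (simp add: complex_nonneg_Reals_iff complex_eq_iff)
qed

lemma psd_zero_diag:
  assumes "psd M" "M $ i $ i = 0"
  shows "M $ i $ j = 0"
proof (rule ccontr)
  assume nz: "M $ i $ j \<noteq> 0"
  define s where "s = (cmod (M $ i $ j))\<^sup>2"
  have s: "s > 0" and sq: "M $ i $ j * cnj (M $ i $ j) = of_real s"
    using nz by (simp_all add: s_def flip: complex_norm_square)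
  \<comment> \<open>With \<open>M $ i $ i = 0\<close> the form at \<open>axis i a + axis j 1\<close>
    is affine in \<open>t\<close> with nonzero slope; this \<open>t\<close> makes its real part
    exactly -1.\<close>
  define t where "t = (Re (M $ j $ j) + 1) / (2 * s)"
  define a where "a = - of_real t * M $ i $ j"
  have "cnj a * M $ i $ i * a + cnj a * M $ i $ j * 1 + cnj 1 * M $ j $ i * a + cnj 1 * M $ j $ j * 1
      = M $ j $ j - 2 * of_real t * (M $ i $ j * cnj (M $ i $ j))"
    using psd_hermitian[OF assms(1), of j i] assms(2) by (simp add: a_def algebra_simps)
  then have "M $ j $ j - 2 * of_real t * of_real s \<in> \<real>\<^sub>\<ge>\<^sub>0"
    using psd_quadratic[OF assms(1), of a i j 1] unfolding sq by (simp only:)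
  then have "- 2 * t * s + Re (M $ j $ j) \<ge> 0"
    by (simp add: complex_nonneg_Reals_iff)
  moreover have "2 * t * s = Re (M $ j $ j) + 1"
    using s by (simp add: t_def)
  ultimately show False by linarith
qed

text \<open>One elimination step of the Cholesky factorisation: the Schur complement of a positive
  diagonal entry is the form \<open>M\<close> evaluated at the vector minus its \<open>M\<close>-projection onto
  the \<open>i\<close>-th axis.\<close>

lemma psd_schur_complement:
  assumes "psd M" and "M $ i $ i \<noteq> 0"
  shows "\<exists>w. psd (M - ketbra w w) \<and>
    (\<forall>j k. ketbra w w $ j $ k = M $ j $ i * M $ i $ k / M $ i $ i)"
proof -
  obtain r where r: "M $ i $ i = of_real r" "r > 0"
    using psd_diag[OF assms(1), of i] assms(2)
    by (metis nonneg_Reals_cases of_real_0 order_less_le)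
  define s where "s = sqrt r"
  have s: "s > 0" "M $ i $ i = of_real s * of_real s"
    using r by (simp_all add: s_def flip: of_real_mult)
  \<comment> \<open>The \<open>i\<close>-th column of \<open>M\<close> over the square root of the
    pivot, so that \<open>ketbra w w\<close> reproduces row and column \<open>i\<close> of
    \<open>M\<close>.\<close>
  define w where "w = (\<chi> j. M $ j $ i / of_real s)"
  have w: "ketbra w w $ j $ k = M $ j $ i * M $ i $ k / M $ i $ i" for j k
    using psd_hermitian[OF assms(1), of i k] s by (simp add: w_def)
  have "psd (M - ketbra w w)"
    unfolding psd_def
  proof
    fix v
    define y where "y = (M *v v) $ i"
    \<comment> \<open>This coefficient makes \<open>v - axis i c\<close> orthogonal to
      \<open>axis i\<close> in the form of \<open>M\<close>; completing the square then subtracts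
      exactly the squared modulus of \<open>cinner w v\<close>.\<close>
    define c where "c = y / M $ i $ i"
    have wv: "cinner w v = y / of_real s"
      by (simp add: cinner_def w_def y_def matrix_vector_mult_def sum_divide_distrib
          flip: psd_hermitian[OF assms(1)])
    have "cinner v (M *v axis i c) = cnj y * c"
      unfolding matrix_vector_mult_axis
      by (simp add: cinner_def y_def matrix_vector_mult_def sum_distrib_left sum_distrib_right
          mult_ac flip: psd_hermitian[OF assms(1)])
    moreover have "cinner (axis i c) (M *v v) = cnj c * y"
      "cinner (axis i c) (M *v axis i c) = cnj c * M $ i $ i * c"
      by (simp_all add: cinner_axis_left y_def matrix_vector_mult_axis)
    ultimately have "cinner (v - axis i c) (M *v (v - axis i c))
        = cinner v (M *v v) - cnj y * c - cnj c * y + cnj c * M $ i $ i * c"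
      by (simp add: matrix_vector_mult_diff_distrib cinner_diff_left cinner_diff_right)
    also have "\<dots> = cinner v (M *v v) - cnj (cinner w v) * cinner w v"
      using s by (simp add: wv c_def)
    also have "\<dots> = cinner v ((M - ketbra w w) *v v)"
      by (simp add: matrix_vector_mult_diff_rdistrib cinner_diff_right cinner_ketbra cnj_cinner)
    finally show "cinner v ((M - ketbra w w) *v v) \<in> \<real>\<^sub>\<ge>\<^sub>0"
      using assms(1) by (metis psd_def)
  qed
  with w show ?thesis by blast
qed

text \<open>Cholesky elimination, by induction on a set \<open>S\<close> containing the indices of
  all nonzero rows. A zero pivot means that its row already vanishes; a nonzero pivot is cleared by
  splitting off one rank-one term, which leaves the rows outside \<open>S\<close> zero.\<close>

lemma psd_decomp_supported:
  assumes "finite S" "psd M" "\<And>j k. j \<notin> S \<Longrightarrow> M $ j $ k = 0"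
  shows "\<exists>(N::nat) w. M = (\<Sum>n<N. ketbra (w n) (w n))"
  using assms
proof (induction S arbitrary: M rule: finite_induct)
  case empty
  then show ?case
    by (intro exI[of _ 0]) (simp add: vec_eq_iff)
next
  case (insert i S)
  show ?case
  proof (cases "M $ i $ i = 0")
    case True
    have "M $ j $ k = 0" if "j \<notin> S" for j k
      using that psd_zero_diag[OF insert.prems(1) True] insert.prems(2)[of j] by (cases "j = i") simp_all
    with insert.prems(1) show ?thesis
      by (rule insert.IH)
  next
    case False
    then obtain w where w: "psd (M - ketbra w w)"
      "\<And>j k. ketbra w w $ j $ k = M $ j $ i * M $ i $ k / M $ i $ i"
      using psd_schur_complement[OF insert.prems(1)] by blast
    have "(M - ketbra w w) $ j $ k = 0" if "j \<notin> S" for j k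
      using that False insert.prems(2)[of j] w(2)[of j k] by (cases "j = i") simp_all
    with w(1) obtain N :: nat and u where u: "M - ketbra w w = (\<Sum>n<N. ketbra (u n) (u n))"
      using insert.IH by blast
    have "M = (\<Sum>n<Suc N. ketbra ((u(N := w)) n) ((u(N := w)) n))"
      using u by (simp add: algebra_simps)
    then show ?thesis by blast
  qed
qed

lemma psd_decomp:
  assumes "psd M"
  obtains N :: nat and w where "M = (\<Sum>n<N. ketbra (w n) (w n))"
  using psd_decomp_supported[of UNIV M] assms by auto

section \<open>Kraus operators\<close>

text \<open>The matrix is the Choi matrix of \<open>\<Phi>\<close>. It arises by applying
  \<open>\<Phi>\<close> blockwise to the array of matrix units, which is positive.\<close>

lemma choi_psd:
  fixes \<Phi> :: "complex ^ 'n ^ 'n \<Rightarrow> complex ^ 'n ^ 'n"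
  assumes "completely_positive \<Phi>"
  shows "psd (\<chi> x y. \<Phi> (ketbra (axis (fst x) 1) (axis (fst y) 1)) $ snd x $ snd y)"
    (is "psd ?C")
  unfolding psd_def
proof
  fix V :: "complex ^ ('n \<times> 'n)"
  \<comment> \<open>\<open>block_psd\<close> numbers blocks by naturals, so \<open>g\<close>
    enumerates the coordinates and the ancilla has dimension \<open>CARD('n)\<close>.\<close>
  obtain g where g: "bij_betw g {..<CARD('n)} (UNIV :: 'n set)"
    using ex_bij_betw_nat_finite[of "UNIV :: 'n set"] by (auto simp: atLeast0LessThan)
  let ?E = "\<lambda>i j. ketbra (axis i 1) (axis j 1) :: complex ^ 'n ^ 'n"
  \<comment> \<open>The array of matrix units is a multiple of the projector onto a maximally
    entangled vector, so its form is a squared modulus.\<close>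
  have "block_psd CARD('n) (\<lambda>i j. ?E (g i) (g j))"
    unfolding block_psd_def
  proof
    fix v :: "nat \<Rightarrow> complex ^ 'n"
    let ?s = "\<Sum>i<CARD('n). v i $ g i"
    have "(\<Sum>i<CARD('n). \<Sum>j<CARD('n). cinner (v i) (?E (g i) (g j) *v v j)) = cnj ?s * ?s"
      unfolding cnj_sum sum_product
      by (intro sum.cong refl)
        (simp add: cinner_ketbra cinner_axis_left flip: cnj_cinner[of "axis _ _"])
    then show "(\<Sum>i<CARD('n). \<Sum>j<CARD('n). cinner (v i) (?E (g i) (g j) *v v j)) \<in> \<real>\<^sub>\<ge>\<^sub>0"
      by (simp only: cnj_mult_self_nonneg)
  qed
  with assms have "block_psd CARD('n) (\<lambda>i j. \<Phi> (?E (g i) (g j)))"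
    by (simp add: completely_positive_def)
  then have "(\<Sum>i<CARD('n). \<Sum>j<CARD('n).
      cinner (\<chi> k. V $ (g i, k)) (\<Phi> (?E (g i) (g j)) *v (\<chi> k. V $ (g j, k)))) \<in> \<real>\<^sub>\<ge>\<^sub>0"
    by (simp add: block_psd_def)
  also have "(\<Sum>i<CARD('n). \<Sum>j<CARD('n).
      cinner (\<chi> k. V $ (g i, k)) (\<Phi> (?E (g i) (g j)) *v (\<chi> k. V $ (g j, k))))
    = (\<Sum>i\<in>UNIV. \<Sum>j\<in>UNIV. cinner (\<chi> k. V $ (i, k)) (\<Phi> (?E i j) *v (\<chi> k. V $ (j, k))))"
    by (subst (1 2) sum.reindex_bij_betw[OF g, symmetric]) (rule refl)
  also have "\<dots> = (\<Sum>i\<in>UNIV. \<Sum>j\<in>UNIV. \<Sum>k\<in>UNIV. \<Sum>l\<in>UNIV.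
      cnj (V $ (i, k)) * (\<Phi> (?E i j) $ k $ l * V $ (j, l)))"
    by (simp add: cinner_def matrix_vector_mult_def sum_distrib_left)
  \<comment> \<open>Grouping \<open>(i, k)\<close> and \<open>(j, l)\<close> gives sums over the
    composite index type.\<close>
  also have "\<dots> = (\<Sum>i\<in>UNIV. \<Sum>k\<in>UNIV. \<Sum>j\<in>UNIV. \<Sum>l\<in>UNIV.
      cnj (V $ (i, k)) * (\<Phi> (?E i j) $ k $ l * V $ (j, l)))"
    by (intro sum.cong refl sum.swap)
  also have "\<dots> = cinner V (?C *v V)"
    by (simp add: cinner_def matrix_vector_mult_def sum_distrib_left sum_UNIV_prod)
  finally show "cinner V (?C *v V) \<in> \<real>\<^sub>\<ge>\<^sub>0" .
qed

lemma matrix_unit_expansion: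
  fixes X :: "complex ^ 'n ^ 'n"
  shows "X = (\<Sum>i\<in>UNIV. \<Sum>j\<in>UNIV. cscale (X $ i $ j) (ketbra (axis i 1) (axis j 1)))"
proof -
  have "(\<Sum>i\<in>UNIV. \<Sum>j\<in>UNIV. X $ i $ j * (axis i 1 $ k * cnj (axis j 1 $ l)))
      = (\<Sum>i\<in>UNIV. \<Sum>j\<in>UNIV. if j = l then (if i = k then X $ i $ j else 0) else 0)" for k l
    by (intro sum.cong refl) (auto simp: axis_def)
  then show ?thesis by (simp add: vec_eq_iff cscale_def)
qed

lemma clinear_map_sum:
  assumes "clinear_map \<Phi>"
  shows "\<Phi> (\<Sum>i\<in>S. X i) = (\<Sum>i\<in>S. \<Phi> (X i))"
proof -
  have "\<Phi> 0 = 0"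
    using assms unfolding clinear_map_def by (metis add_cancel_left_left)
  then show ?thesis
    using assms by (induction S rule: infinite_finite_induct) (simp_all add: clinear_map_def)
qed

lemma clinear_map_cscale: "clinear_map \<Phi> \<Longrightarrow> \<Phi> (cscale c X) = cscale c (\<Phi> X)"
  by (simp add: clinear_map_def)

text \<open>Choi's argument: each rank-one term of the Choi matrix, read as a matrix, is a Kraus
  operator. The Kraus form holds on matrix units and extends by linearity; trace preservation on
  matrix units gives the completeness relation.\<close>

lemma cptp_kraus:
  fixes \<Phi> :: "complex ^ 'n ^ 'n \<Rightarrow> complex ^ 'n ^ 'n"
  assumes "cptp \<Phi>"
  shows "\<exists>(N :: nat) B. (\<forall>X. \<Phi> X = (\<Sum>n<N. B n ** X ** dagger (B n))) \<and>
    (\<Sum>n<N. dagger (B n) ** B n) = mat 1"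
proof -
  let ?E = "\<lambda>i j. ketbra (axis i 1) (axis j 1) :: complex ^ 'n ^ 'n"
  let ?C = "\<chi> x y. \<Phi> (?E (fst x) (fst y)) $ snd x $ snd y"
  have lin: "clinear_map \<Phi>" and cp: "completely_positive \<Phi>" and tr: "trace (\<Phi> X) = trace X" for X
    using assms by (auto simp: cptp_def)
  obtain N :: nat and w where w: "?C = (\<Sum>n<N. ketbra (w n) (w n))"
    using psd_decomp[OF choi_psd[OF cp]] .
  \<comment> \<open>The vector \<open>w n\<close> is reshaped into a matrix: the first component of
    its index, which labels the input matrix unit, becomes the column.\<close>
  define B :: "nat \<Rightarrow> complex ^ 'n ^ 'n" where "B n = (\<chi> k i. w n $ (i, k))" for n
  have E: "\<Phi> (?E i j) $ k $ l = (\<Sum>n<N. B n $ k $ i * cnj (B n $ l $ j))" for i j k l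
    using arg_cong[OF w, of "\<lambda>M. M $ (i, k) $ (j, l)"] by (simp add: B_def)
  have "\<Phi> X = (\<Sum>n<N. B n ** X ** dagger (B n))" for X
  proof -
    have "\<Phi> X $ k $ l = (\<Sum>n<N. B n ** X ** dagger (B n)) $ k $ l" for k l
    proof -
      have "\<Phi> X = (\<Sum>i\<in>UNIV. \<Sum>j\<in>UNIV. cscale (X $ i $ j) (\<Phi> (?E i j)))"
        by (subst matrix_unit_expansion[of X]) (simp add: clinear_map_sum[OF lin] clinear_map_cscale[OF lin])
      then have "\<Phi> X $ k $ l = (\<Sum>i\<in>UNIV. \<Sum>j\<in>UNIV. \<Sum>n<N. X $ i $ j * (B n $ k $ i * cnj (B n $ l $ j)))"
        by (simp add: cscale_def E sum_distrib_left)
      also have "\<dots> = (\<Sum>i\<in>UNIV. \<Sum>n<N. \<Sum>j\<in>UNIV. X $ i $ j * (B n $ k $ i * cnj (B n $ l $ j)))"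
        by (intro sum.cong refl sum.swap)
      also have "\<dots> = (\<Sum>n<N. \<Sum>i\<in>UNIV. \<Sum>j\<in>UNIV. X $ i $ j * (B n $ k $ i * cnj (B n $ l $ j)))"
        by (rule sum.swap)
      also have "\<dots> = (\<Sum>n<N. \<Sum>j\<in>UNIV. \<Sum>i\<in>UNIV. X $ i $ j * (B n $ k $ i * cnj (B n $ l $ j)))"
        by (intro sum.cong refl sum.swap)
      also have "\<dots> = (\<Sum>n<N. B n ** X ** dagger (B n)) $ k $ l"
        by (simp add: matrix_mult_nth sum_distrib_left sum_distrib_right mult_ac)
      finally show ?thesis .
    qed
    then show ?thesis by (simp add: vec_eq_iff)
  qed
  moreover have "(\<Sum>n<N. dagger (B n) ** B n) = mat 1"
  proof -
    have "(\<Sum>n<N. dagger (B n) ** B n) $ j $ i = mat 1 $ j $ i" for i j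
    proof -
      \<comment> \<open>The trace of \<open>\<Phi> (?E i j)\<close> is entry \<open>(j, i)\<close>
        of the completeness sum, while the trace of the matrix unit itself is a Kronecker
        delta.\<close>
      have "(\<Sum>n<N. dagger (B n) ** B n) $ j $ i = trace (\<Phi> (?E i j))"
        by (simp add: trace_def E matrix_mult_nth mult.commute, subst sum.swap, simp)
      also have "\<dots> = (\<Sum>k\<in>UNIV. if k = i then (if j = i then 1 else 0) else 0)"
        unfolding tr unfolding trace_def by (intro sum.cong refl) (auto simp: axis_def)
      finally show ?thesis by (simp add: mat_def)
    qed
    then show ?thesis by (simp add: vec_eq_iff)
  qed
  ultimately show ?thesis by blast
qed

section \<open>Local channels on the second factor as operations on the composite system\<close>

lemma kron_mat_1_mult_nth:
  "(kron (mat 1) B ** X) $ x $ y = (\<Sum>k\<in>UNIV. B $ snd x $ k * X $ (fst x, k) $ y)"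
proof -
  have "(kron (mat 1) B ** X) $ x $ y
      = (\<Sum>i\<in>UNIV. \<Sum>k\<in>UNIV. if i = fst x then B $ snd x $ k * X $ (i, k) $ y else 0)"
    unfolding matrix_mult_nth
    by (simp add: sum.cartesian_product flip: UNIV_Times_UNIV)
      (rule sum.cong, auto simp: mat_def)
  also have "\<dots> = (\<Sum>i\<in>UNIV. if i = fst x then (\<Sum>k\<in>UNIV. B $ snd x $ k * X $ (i, k) $ y) else 0)"
    by (intro sum.cong refl) auto
  finally show ?thesis by simp
qed

lemma mult_kron_mat_1_nth:
  "(X ** kron (mat 1) B) $ x $ y = (\<Sum>k\<in>UNIV. X $ x $ (fst y, k) * B $ k $ snd y)"
proof -
  have "(X ** kron (mat 1) B) $ x $ y
      = (\<Sum>i\<in>UNIV. \<Sum>k\<in>UNIV. if i = fst y then X $ x $ (i, k) * B $ k $ snd y else 0)"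
    unfolding matrix_mult_nth
    by (simp add: sum.cartesian_product flip: UNIV_Times_UNIV)
      (rule sum.cong, auto simp: mat_def)
  also have "\<dots> = (\<Sum>i\<in>UNIV. if i = fst y then (\<Sum>k\<in>UNIV. X $ x $ (i, k) * B $ k $ snd y) else 0)"
    by (intro sum.cong refl) auto
  finally show ?thesis by simp
qed

text \<open>Multiplication by \<open>kron (mat 1) (B n)\<close> on either side leaves the first
  index component alone, so each block undergoes the Kraus sum of \<open>\<Phi>\<close>
  separately.\<close>

lemma id_tensor_kraus:
  assumes "\<And>X. \<Phi> X = (\<Sum>n<N. B n ** X ** dagger (B n))"
  shows "id_tensor \<Phi> X = (\<Sum>n<N::nat. kron (mat 1) (B n) ** X ** dagger (kron (mat 1) (B n)))"
  by (simp add: vec_eq_iff id_tensor_def assms dagger_kron mult_kron_mat_1_nth kron_mat_1_mult_nth)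
    (simp add: matrix_mult_nth)

lemma incoherent_kraus_mat_1: "incoherent_kraus J (mat 1)"
  by (simp add: incoherent_kraus_def incoherent_state_def)

lemma id_tensor_SQI:
  assumes "cptp \<Phi>"
  shows "SQI_operation J (id_tensor \<Phi>)"
proof -
  obtain N :: nat and B where B: "\<And>X. \<Phi> X = (\<Sum>n<N. B n ** X ** dagger (B n))"
    "(\<Sum>n<N. dagger (B n) ** B n) = mat 1"
    using cptp_kraus[OF assms] by blast
  show ?thesis
    unfolding SQI_operation_def
    by (rule exI[of _ N], rule exI[of _ "\<lambda>_. mat 1"], rule exI[of _ B])
      (simp add: incoherent_kraus_mat_1 B(2) fun_eq_iff id_tensor_kraus[OF B(1)] flip: kron_sum_right)
qed

text \<open>The infimum at the output of a channel is bounded below only once that output is known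
  to be a state. The trace is preserved by cyclicity and completeness.\<close>

lemma state_SQI:
  assumes "SQI_operation J \<Lambda>" "state \<rho>"
  shows "state (\<Lambda> \<rho>)"
proof -
  obtain N :: nat and A B where
    1: "(\<Sum>n<N. kron (dagger (A n) ** A n) (dagger (B n) ** B n)) = mat 1" and
    \<Lambda>: "\<Lambda> = (\<lambda>\<rho>. \<Sum>n<N. kron (A n) (B n) ** \<rho> ** dagger (kron (A n) (B n)))"
    using assms(1) unfolding SQI_operation_def by blast
  have "trace (\<Lambda> \<rho>) = (\<Sum>n<N. trace (kron (dagger (A n) ** A n) (dagger (B n) ** B n) ** \<rho>))"
    unfolding \<Lambda> trace_sum
    by (intro sum.cong refl) (metis trace_mult_commute matrix_mul_assoc dagger_kron kron_mult)
  also have "\<dots> = trace ((\<Sum>n<N. kron (dagger (A n) ** A n) (dagger (B n) ** B n)) ** \<rho>)"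
    by (simp add: trace_sum conj_sum[where K = "mat 1" and L = \<rho>, simplified])
  finally show ?thesis
    using assms(2) by (simp add: 1 state_def) (simp add: \<Lambda> psd_sum psd_conj)
qed

text \<open>In each Kraus term the outer factors act on the first system and the Kraus operator on
  the second, so they commute.\<close>

lemma id_tensor_conj:
  assumes "cptp \<Phi>"
  shows "kron U (mat 1) ** id_tensor \<Phi> \<rho> ** kron V (mat 1)
    = id_tensor \<Phi> (kron U (mat 1) ** \<rho> ** kron V (mat 1))"
proof -
  obtain N :: nat and B where B: "\<And>X. \<Phi> X = (\<Sum>n<N. B n ** X ** dagger (B n))"
    "(\<Sum>n<N. dagger (B n) ** B n) = mat 1"
    using cptp_kraus[OF assms] by blast
  have "kron U (mat 1) ** (kron (mat 1) C ** \<rho> ** dagger (kron (mat 1) C)) ** kron V (mat 1)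
    = kron (mat 1) C ** (kron U (mat 1) ** \<rho> ** kron V (mat 1)) ** dagger (kron (mat 1) C)" for C
  proof -
    have "kron U (mat 1) ** (kron (mat 1) C ** \<rho> ** dagger (kron (mat 1) C)) ** kron V (mat 1)
      = (kron U (mat 1) ** kron (mat 1) C) ** \<rho> ** (kron (mat 1) (dagger C) ** kron V (mat 1))"
      by (simp add: matrix_mul_assoc dagger_kron)
    also have "\<dots> = (kron (mat 1) C ** kron U (mat 1)) ** \<rho> ** (kron V (mat 1) ** kron (mat 1) (dagger C))"
      by (simp add: kron_mult)
    finally show ?thesis by (simp add: matrix_mul_assoc dagger_kron)
  qed
  then show ?thesis
    by (simp add: id_tensor_kraus[OF B(1)] conj_sum)
qed

section \<open>Orthonormal families\<close>

text \<open>The Gram matrix of the columns gives one of the two unitarity equations; for a square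
  matrix the other follows.\<close>

lemma orthonormal_basis_unitary:
  assumes "orthonormal_basis J"
  shows "unitary (\<chi> i j. J j $ i)"
proof -
  have "dagger (\<chi> i j. J j $ i) ** (\<chi> i j. J j $ i) = mat 1"
    using assms
    by (auto simp: orthonormal_basis_def orthonormal_on_def cinner_def vec_eq_iff matrix_mult_nth mat_def)
  then show ?thesis
    by (simp add: unitary_def matrix_left_right_inverse)
qed

lemma orthonormal_basis_orthogonal_eq_0:
  assumes "orthonormal_basis J" "\<And>j. cinner (J j) x = 0"
  shows "x = 0"
proof -
  have "dagger (\<chi> i j. J j $ i) *v x = 0"
    using assms(2) by (simp add: vec_eq_iff matrix_vector_mult_def cinner_def)
  then have "(\<chi> i j. J j $ i) *v (dagger (\<chi> i j. J j $ i) *v x) = 0"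
    by simp
  then show ?thesis
    using orthonormal_basis_unitary[OF assms(1)] by (simp add: matrix_vector_mul_assoc unitary_def)
qed

text \<open>Otherwise the first \<open>CARD('a)\<close> vectors already form a basis, and the next
  one, orthogonal to all of them, would vanish despite having norm 1.\<close>

lemma orthonormal_on_card_le:
  fixes v :: "nat \<Rightarrow> complex ^ 'a"
  assumes "orthonormal_on {..<N} v"
  shows "N \<le> CARD('a)"
proof (rule ccontr)
  assume N: "\<not> N \<le> CARD('a)"
  obtain h where h: "bij_betw h (UNIV :: 'a set) {..<CARD('a)}"
    using ex_bij_betw_finite_nat[of "UNIV :: 'a set"] by (auto simp: atLeast0LessThan)
  then have hlt: "h a < CARD('a)" for a by (auto simp: bij_betw_def)
  have hinj: "h a = h b \<longleftrightarrow> a = b" for a b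
    using h by (auto simp: bij_betw_def inj_on_def)
  have hN: "h a < N" for a using hlt[of a] N by simp
  have "orthonormal_basis (\<lambda>a. v (h a))"
    using assms by (simp add: orthonormal_basis_def orthonormal_on_def hN hinj)
  moreover have "cinner (v (h a)) (v CARD('a)) = 0" for a
    using assms N hlt[of a] hN[of a] by (simp add: orthonormal_on_def)
  ultimately have "v CARD('a) = 0" by (rule orthonormal_basis_orthogonal_eq_0)
  then have "cinner (v CARD('a)) (v CARD('a)) = 0"
    by (simp add: cinner_self_eq_0_iff)
  then show False
    using assms N by (simp add: orthonormal_on_def)
qed

text \<open>The conjugated vectors, padded by zero rows, form a singular square matrix, and any kernel
  vector of it is orthogonal to the family.\<close>

lemma orthonormal_on_insert:
  fixes v :: "'a::finite \<Rightarrow> complex ^ 'a"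
  assumes "orthonormal_on S v" "i \<notin> S"
  obtains x where "orthonormal_on (insert i S) (v(i := x))"
proof -
  define M :: "complex ^ 'a ^ 'a" where "M = (\<chi> j k. if j \<in> S then cnj (v j $ k) else 0)"
  \<comment> \<open>A left inverse would also be a right inverse, but row \<open>i\<close> of
    \<open>M\<close> is zero.\<close>
  have "\<nexists>B. B ** M = mat 1"
  proof
    assume "\<exists>B. B ** M = mat 1"
    then obtain B where "M ** B = mat 1" using matrix_left_right_inverse by blast
    then have "(M ** B) $ i $ i = 1" by (simp add: mat_def)
    then show False using assms(2) by (simp add: M_def matrix_mult_nth)
  qed
  then obtain x where x: "M *v x = 0" "x \<noteq> 0"
    unfolding matrix_left_invertible_ker by blast
  define r where "r = (\<Sum>i\<in>UNIV. (cmod (x $ i))\<^sup>2)"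
  have r: "cinner x x = of_real r" "r > 0"
    using x(2) cinner_self_eq_0_iff[of x] unfolding cinner_self
    by (auto simp: r_def order_less_le sum_nonneg simp del: of_real_sum)
  define s where "s = inverse (sqrt r)"
  define y where "y = of_real s *s x"
  have "cinner y y = of_real (s * s * r)"
    by (simp add: y_def cinner_scale r(1))
  then have yy: "cinner y y = 1"
    using r(2) by (simp add: s_def field_simps)
  have vy: "cinner (v j) y = 0" if "j \<in> S" for j
  proof -
    have "(M *v x) $ j = cinner (v j) x"
      using that by (simp add: M_def cinner_def matrix_vector_mult_def)
    with x(1) have "cinner (v j) x = 0" by simp
    then show ?thesis using cinner_scale[of 1 "v j" "of_real s" x] by (simp add: y_def)
  qed
  have yv: "cinner y (v j) = 0" if "j \<in> S" for j
    using vy[OF that] cnj_cinner[of "v j" y] by simp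
  have "orthonormal_on (insert i S) (v(i := y))"
    using assms by (auto simp: orthonormal_on_def yy vy yv)
  then show ?thesis by (rule that)
qed

text \<open>The missing indices are filled one at a time, by induction on the size of the complement
  of \<open>S\<close>; vectors already placed are never changed.\<close>

lemma orthonormal_on_extend:
  fixes v :: "'a::finite \<Rightarrow> complex ^ 'a"
  assumes "orthonormal_on S v"
  shows "\<exists>u. orthonormal_basis u \<and> (\<forall>j\<in>S. u j = v j)"
  using assms
proof (induction "card (- S)" arbitrary: S v)
  case 0
  then have "S = UNIV" by auto
  with 0 show ?case unfolding orthonormal_basis_def by blast
next
  case (Suc n)
  then obtain i where i: "i \<notin> S" by (metis card.empty Compl_iff all_not_in_conv nat.distinct(1))
  obtain x where x: "orthonormal_on (insert i S) (v(i := x))"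
    using orthonormal_on_insert[OF Suc.prems i] .
  have "n = card (- insert i S)"
    using Suc.hyps(2) i by (simp add: Compl_insert)
  from Suc.hyps(1)[OF this x] obtain u where
    "orthonormal_basis u" "\<forall>j\<in>insert i S. u j = (v(i := x)) j" by blast
  with i show ?case by (metis fun_upd_other insertI2)
qed

text \<open>With the bases as columns of \<open>?V\<close> and \<open>?W\<close>, the unitary is
  \<open>?W ** dagger ?V\<close>: it sends \<open>v j\<close> to the \<open>j\<close>-th coordinate
  vector and on to \<open>w j\<close>.\<close>

lemma orthonormal_basis_transition:
  assumes "orthonormal_basis v" "orthonormal_basis w"
  obtains U where "unitary U" "\<And>j. U *v v j = w j"
proof -
  let ?V = "\<chi> i j. v j $ i" and ?W = "\<chi> i j. w j $ i"
  have V: "unitary ?V" and W: "unitary ?W"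
    using assms by (simp_all add: orthonormal_basis_unitary)
  have col: "(\<chi> i j. u j $ i) *v axis j 1 = u j" for u :: "'a \<Rightarrow> complex ^ 'a" and j
    by (simp add: matrix_vector_mult_axis vec_eq_iff)
  have "(?W ** dagger ?V) *v v j = w j" for j
  proof -
    have "(?W ** dagger ?V) *v (?V *v axis j 1) = ?W *v ((dagger ?V ** ?V) *v axis j 1)"
      by (simp add: matrix_vector_mul_assoc matrix_mul_assoc)
    also have "\<dots> = w j" using V by (simp add: unitary_def col)
    finally show ?thesis by (simp add: col)
  qed
  moreover have "unitary (?W ** dagger ?V)"
    using V W by (simp add: unitary_mult unitary_dagger)
  ultimately show ?thesis using that by blast
qed

lemma CQ_state_rotate_IQ:
  fixes J :: "'a::finite \<Rightarrow> complex ^ 'a" and \<sigma> :: "complex ^ ('a \<times> 'b::finite) ^ ('a \<times> 'b)"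
  assumes "orthonormal_basis J" "CQ_state \<sigma>"
  obtains U where "unitary U" "IQ_state J (kron U (mat 1) ** \<sigma> ** kron (dagger U) (mat 1))"
proof -
  obtain N :: nat and v :: "nat \<Rightarrow> complex ^ 'a" and p and \<rho> :: "nat \<Rightarrow> complex ^ 'b ^ 'b" where
    v: "orthonormal_on {..<N} v" and p: "\<forall>n<N. 0 \<le> p n" "(\<Sum>n<N. p n) = 1" and
    \<rho>: "\<forall>n<N. state (\<rho> n)" and
    \<sigma>: "\<sigma> = (\<Sum>n<N. p n *\<^sub>R kron (ketbra (v n) (v n)) (\<rho> n))"
    using assms(2) unfolding CQ_state_def by blast
  have "N > 0" using p(2) by (cases N) auto
  \<comment> \<open>The family is numbered by naturals, while \<open>J\<close> is indexed by
    coordinates. The dimension bound allows an injection \<open>g\<close>, and \<open>h\<close>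
    undoes it on its image \<open>S\<close>.\<close>
  obtain g where g: "inj_on g {..<N}" "g ` {..<N} \<subseteq> (UNIV :: 'a set)"
    using card_le_inj[of "{..<N}" "UNIV :: 'a set"] orthonormal_on_card_le[OF v] by auto
  define S where "S = g ` {..<N}"
  define h where "h = inv_into {..<N} g"
  have hg: "h (g n) = n" if "n < N" for n
    using g(1) that by (simp add: h_def)
  have "orthonormal_on S (\<lambda>j. v (h j))"
    using v by (auto simp: orthonormal_on_def S_def hg inj_on_eq_iff[OF g(1)])
  then obtain u where u: "orthonormal_basis u" "\<And>j. j \<in> S \<Longrightarrow> u j = v (h j)"
    using orthonormal_on_extend by blast
  obtain U where U: "unitary U" "\<And>j. U *v u j = J j"
    using orthonormal_basis_transition[OF u(1) assms(1)] by metis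
  have Uv: "U *v v n = J (g n)" if "n < N" for n
    using U(2)[of "g n"] u(2)[of "g n"] that by (simp add: hg S_def)
  \<comment> \<open>Indices outside \<open>S\<close> get weight zero, but an IQ state needs a state
    at every index; \<open>\<rho> 0\<close> serves as filler, available because
    \<open>N > 0\<close>.\<close>
  define q where "q j = (if j \<in> S then p (h j) else 0)" for j
  define \<tau> where "\<tau> j = (if j \<in> S then \<rho> (h j) else \<rho> 0)" for j
  \<comment> \<open>Stated for an arbitrary real vector space so that it transports both the mixture
    and the total probability.\<close>
  have sum_q: "(\<Sum>j\<in>UNIV. q j *\<^sub>R F j) = (\<Sum>n<N. p n *\<^sub>R F (g n))" for F :: "'a \<Rightarrow> 'c::real_vector"
  proof -
    have "(\<Sum>j\<in>UNIV. q j *\<^sub>R F j) = (\<Sum>j\<in>S. q j *\<^sub>R F j)"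
      by (rule sum.mono_neutral_right) (auto simp: q_def)
    also have "\<dots> = (\<Sum>n<N. q (g n) *\<^sub>R F (g n))"
      unfolding S_def by (rule sum.reindex_cong[OF g(1)]) auto
    also have "\<dots> = (\<Sum>n<N. p n *\<^sub>R F (g n))"
      by (intro sum.cong refl) (simp add: q_def S_def hg)
    finally show ?thesis .
  qed
  have "kron U (mat 1) ** \<sigma> ** kron (dagger U) (mat 1)
      = (\<Sum>n<N. p n *\<^sub>R kron (ketbra (J (g n)) (J (g n))) (\<rho> n))"
    unfolding \<sigma> conj_sum_scaleR by (intro sum.cong refl) (simp add: kron_mult ketbra_conj Uv)
  also have "\<dots> = (\<Sum>j\<in>UNIV. q j *\<^sub>R kron (ketbra (J j) (J j)) (\<tau> j))"
    unfolding sum_q by (intro sum.cong refl) (simp add: \<tau>_def S_def hg)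
  finally have eq: "kron U (mat 1) ** \<sigma> ** kron (dagger U) (mat 1) = \<dots>" .
  have "\<forall>j. 0 \<le> q j" "\<forall>j. state (\<tau> j)"
    using p(1) \<rho> \<open>N > 0\<close> by (auto simp: q_def \<tau>_def S_def hg)
  moreover have "(\<Sum>j\<in>UNIV. q j) = 1"
    using sum_q[of "\<lambda>_. 1 :: real"] p(2) by simp
  ultimately have "IQ_state J (kron U (mat 1) ** \<sigma> ** kron (dagger U) (mat 1))"
    unfolding IQ_state_def eq by blast
  with U(1) show ?thesis by (rule that)
qed

section \<open>Classical-quantum states are density operators\<close>

lemma psd_scaleR: "psd M \<Longrightarrow> 0 \<le> r \<Longrightarrow> psd (r *\<^sub>R M)"
  by (simp add: psd_def cinner_scaleR_mult complex_nonneg_Reals_iff)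

lemma kron_ketbra:
  "kron (ketbra v w) (ketbra x y) = ketbra (\<chi> k. v $ fst k * x $ snd k) (\<chi> k. w $ fst k * y $ snd k)"
  by (simp add: vec_eq_iff mult_ac)

text \<open>Splitting \<open>M\<close> into rank-one terms reduces the claim to products of rank-one
  projectors, which are again of rank-one form.\<close>

lemma psd_kron_ketbra:
  assumes "psd M"
  shows "psd (kron (ketbra v v) M)"
proof -
  obtain N :: nat and w where w: "M = (\<Sum>n<N. ketbra (w n) (w n))"
    using psd_decomp[OF assms] .
  show ?thesis
    unfolding w kron_sum_right by (intro psd_sum) (simp_all add: kron_ketbra psd_ketbra)
qed

lemma trace_kron: "trace (kron A B) = trace A * trace B"
  by (simp add: trace_def sum_product sum.cartesian_product split_def flip: UNIV_Times_UNIV)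

lemma trace_scaleR: "trace (r *\<^sub>R M) = r *\<^sub>R trace (M :: complex ^ 'n ^ 'n)"
  by (simp add: trace_def scaleR_sum_right)

lemma trace_ketbra: "trace (ketbra v w) = cinner w v"
  by (simp add: trace_def cinner_def mult.commute)

text \<open>The lower bound on the infimum holds at states, so (D1) first needs classical-quantum
  operators to be states.\<close>

lemma state_CQ:
  assumes "CQ_state \<sigma>"
  shows "state \<sigma>"
proof -
  obtain N :: nat and v p \<rho> where
    v: "orthonormal_on {..<N} v" and p: "\<forall>n<N. 0 \<le> p n" "(\<Sum>n<N. p n) = 1" and
    \<rho>: "\<forall>n<N. state (\<rho> n)" and
    \<sigma>: "\<sigma> = (\<Sum>n<N. p n *\<^sub>R kron (ketbra (v n) (v n)) (\<rho> n))"
    using assms unfolding CQ_state_def by blast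
  have "psd \<sigma>"
    unfolding \<sigma> using p(1) \<rho> by (intro psd_sum psd_scaleR psd_kron_ketbra) (auto simp: state_def)
  moreover have "trace \<sigma> = (\<Sum>n<N. of_real (p n))"
    unfolding \<sigma> trace_sum
  proof (intro sum.cong refl)
    fix n assume "n \<in> {..<N}"
    then have "trace (kron (ketbra (v n) (v n)) (\<rho> n)) = 1"
      using v \<rho> by (simp add: trace_kron trace_ketbra orthonormal_on_def state_def)
    then show "trace (p n *\<^sub>R kron (ketbra (v n) (v n)) (\<rho> n)) = of_real (p n)"
      by (simp add: trace_scaleR of_real_def)
  qed
  ultimately show ?thesis
    using p(2) by (simp add: state_def flip: of_real_sum)
qed

section \<open>The discord axioms for the infimum over rotations of the first system\<close>

theorem theorem2:
  fixes J :: "'a::finite \<Rightarrow> complex ^ 'a"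
    and BD :: "complex ^ ('a \<times> 'b::finite) ^ ('a \<times> 'b) \<Rightarrow> real"
  assumes "orthonormal_basis J"
    and "basis_dependent_discord J BD"
  shows "discord_measure
    (\<lambda>\<rho>. INF U \<in> {U :: complex ^ 'a ^ 'a. unitary U}.
           BD (kron U (mat 1) ** \<rho> ** kron (dagger U) (mat 1)))"
proof -
  let ?rot = "\<lambda>U \<rho>. kron U (mat 1) ** \<rho> ** kron (dagger U) (mat 1)
    :: complex ^ ('a \<times> 'b) ^ ('a \<times> 'b)"
  let ?\<U> = "{U :: complex ^ 'a ^ 'a. unitary U}"
  let ?D = "\<lambda>\<rho>. INF U \<in> ?\<U>. BD (?rot U \<rho>)"
  have BD_nonneg: "0 \<le> BD \<rho>" if "state \<rho>" for \<rho>
    using assms(2) that by (simp add: basis_dependent_discord_def)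
  have BD_IQ: "BD \<sigma> = 0" if "IQ_state J \<sigma>" for \<sigma>
    using assms(2) that by (simp add: basis_dependent_discord_def)
  have BD_SQI: "BD (\<Lambda> \<rho>) \<le> BD \<rho>" if "SQI_operation J \<Lambda>" "state \<rho>" for \<Lambda> \<rho>
    using assms(2) that by (simp add: basis_dependent_discord_def)
  have BD_unitary: "BD (kron U V ** \<rho> ** dagger (kron U V)) = BD \<rho>"
    if "incoherent_unitary J U" "unitary V" "state \<rho>" for U V \<rho>
    using assms(2) that by (simp add: basis_dependent_discord_def)
  have state_rot: "state (?rot U \<rho>)" if "state \<rho>" "unitary U" for U \<rho>
    using state_conj_unitary[OF that(1) unitary_kron[OF that(2) unitary_mat_1]]
    by (simp add: dagger_kron)
  have rot_nonneg: "0 \<le> BD (?rot U \<rho>)" if "state \<rho>" "unitary U" for U \<rho>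
    using that by (intro BD_nonneg state_rot)
  have ne: "?\<U> \<noteq> {}" using unitary_mat_1 by blast
  \<comment> \<open>Comparing real infima requires boundedness below; nonnegativity of
    \<open>BD\<close> at the rotated states supplies the bound 0.\<close>
  have bdd: "bdd_below ((\<lambda>U. BD (?rot U \<rho>)) ` ?\<U>)" if "state \<rho>" for \<rho>
    using rot_nonneg[OF that] by (intro bdd_belowI2[of _ 0]) simp
  have nonneg: "0 \<le> ?D \<rho>" if "state \<rho>" for \<rho>
    using rot_nonneg[OF that] by (intro cINF_greatest[OF ne]) simp
  show ?thesis
    unfolding discord_measure_def
  proof (intro conjI allI impI)
    fix \<rho> :: "complex ^ ('a \<times> 'b) ^ ('a \<times> 'b)"
    assume "state \<rho>"
    then show "0 \<le> ?D \<rho>" by (rule nonneg)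
  next
    fix \<sigma> :: "complex ^ ('a \<times> 'b) ^ ('a \<times> 'b)"
    assume \<sigma>: "CQ_state \<sigma>"
    obtain U where U: "unitary U" "IQ_state J (?rot U \<sigma>)"
      using CQ_state_rotate_IQ[OF assms(1) \<sigma>] .
    \<comment> \<open>The single rotation to an IQ state gives the upper bound 0; nonnegativity
      gives the other inequality.\<close>
    have "?D \<sigma> \<le> BD (?rot U \<sigma>)"
      using U(1) by (intro cINF_lower bdd state_CQ \<sigma>) simp
    then show "?D \<sigma> = 0"
      using nonneg[OF state_CQ[OF \<sigma>]] BD_IQ[OF U(2)] by simp
  next
    fix \<Phi> :: "complex ^ 'b ^ 'b \<Rightarrow> complex ^ 'b ^ 'b" and \<rho> :: "complex ^ ('a \<times> 'b) ^ ('a \<times> 'b)"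
    assume \<Phi>: "cptp \<Phi>" and \<rho>: "state \<rho>"
    have SQI: "SQI_operation J (id_tensor \<Phi>)"
      by (rule id_tensor_SQI[OF \<Phi>])
    show "?D (id_tensor \<Phi> \<rho>) \<le> ?D \<rho>"
    proof (rule cINF_mono[OF ne bdd[OF state_SQI[OF SQI \<rho>]]])
      fix U assume "U \<in> ?\<U>"
      then have "BD (?rot U (id_tensor \<Phi> \<rho>)) \<le> BD (?rot U \<rho>)"
        unfolding id_tensor_conj[OF \<Phi>] using \<rho> by (intro BD_SQI[OF SQI] state_rot) auto
      with \<open>U \<in> ?\<U>\<close> show "\<exists>V\<in>?\<U>. BD (?rot V (id_tensor \<Phi> \<rho>)) \<le> BD (?rot U \<rho>)" by blast
    qed
  next
    fix U :: "complex ^ 'a ^ 'a" and V :: "complex ^ 'b ^ 'b" and \<rho> :: "complex ^ ('a \<times> 'b) ^ ('a \<times> 'b)"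
    assume U: "unitary U" and V: "unitary V" and \<rho>: "state \<rho>"
    have eq: "BD (?rot W (kron U V ** \<rho> ** dagger (kron U V))) = BD (?rot (W ** U) \<rho>)"
      if W: "unitary W" for W
    proof -
      have "?rot W (kron U V ** \<rho> ** dagger (kron U V))
          = (kron W (mat 1) ** kron U V) ** \<rho> ** dagger (kron W (mat 1) ** kron U V)"
        by (simp add: dagger_mult dagger_kron matrix_mul_assoc)
      \<comment> \<open>The factor \<open>V\<close> is moved to the left, making it the outermost
        conjugation; (BD3) with \<open>mat 1\<close> as incoherent unitary then removes it.\<close>
      also have "kron W (mat 1) ** kron U V = kron (mat 1) V ** kron (W ** U) (mat 1)"
        by (simp add: kron_mult)
      finally have "?rot W (kron U V ** \<rho> ** dagger (kron U V))
          = kron (mat 1) V ** ?rot (W ** U) \<rho> ** dagger (kron (mat 1) V)"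
        by (simp only: dagger_mult dagger_kron matrix_mul_assoc dagger_mat_1)
      then show ?thesis
        using BD_unitary[of "mat 1" V "?rot (W ** U) \<rho>"] V state_rot[OF \<rho> unitary_mult[OF W U]]
        by (simp add: incoherent_unitary_def incoherent_kraus_mat_1)
    qed
    \<comment> \<open>Right translation by \<open>U\<close> permutes the unitary group, so both
      infima range over the same values.\<close>
    have "(\<lambda>W. W ** U) ` ?\<U> = ?\<U>"
    proof (intro equalityI subsetI)
      fix W assume "W \<in> ?\<U>"
      then have "W ** dagger U \<in> ?\<U>" "W = W ** dagger U ** U"
        using U by (simp_all add: unitary_mult unitary_dagger)
          (simp add: unitary_def flip: matrix_mul_assoc)
      then show "W \<in> (\<lambda>W. W ** U) ` ?\<U>" by blast
    qed (use U in \<open>auto intro: unitary_mult\<close>)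
    then have "?D \<rho> = (INF W \<in> (\<lambda>W. W ** U) ` ?\<U>. BD (?rot W \<rho>))"
      by simp
    also have "\<dots> = ?D (kron U V ** \<rho> ** dagger (kron U V))"
      unfolding image_image by (intro INF_cong refl) (simp add: eq)
    finally show "?D (kron U V ** \<rho> ** dagger (kron U V)) = ?D \<rho>" ..
  qed
qed

end
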